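(* Let $A\in\mathbb{R}^{N\times n}$, let $\varepsilon,\delta\in(0,1)$ and let $k$ be a target rank. Let $S\in\mathbb{R}^{m\times N}$ be a $\delta$-subspace embedding of $A$. Let $J$ be the set of column indices produced by norm sampling with target rank $k$ applied to $SA$, and let $X^*\in\operatorname{argmin}_X\|SA_{:,J}X-SA\|$. Then for a reference rank $r$, $$\mathbb{E}\min_X\|A-A_{:,J}X\|^2\le(1+\varepsilon)\|A-A^{(r)}\|^2$$ provided that $$k\ge\frac{1+\delta}{1-\delta}\left(\frac r\varepsilon+r\log\Big(\frac1{\varepsilon\eta}\Big)\right),\qquad \eta=\frac{\|A-A^{(r)}\|^2}{\|A\|^2}.$$ Consequently, under the same condition on $k$, the matrix ID error satisfies $$\mathbb{E}\|A-A_{:,J}X^*\|^2\le(1+\varepsilon)(1-\delta)^{-1}\|A-A^{(r)}\|^2.$$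
   Context: All norms are Frobenius ($\ell_2$) norms. $A^{(r)}$ is a best approximation of $A$ of rank at most $r$. $A_{:,J}$ is the submatrix of columns indexed by $J$. $S$ is a $\delta$-subspace embedding ($\delta$-SE) of $A$ if $(1-\delta)\|x\|^2\le\|Sx\|^2\le(1+\delta)\|x\|^2$ for all $x$ in the column space of $A$. Norm sampling (randomly pivoted QR) with target rank $k$ on a matrix $B$ with $n$ columns: start with $I=\emptyset$; repeat $k$ times: with $Q_I$ an orthonormal basis of the span of the columns $B_{:,I}$, set $d_i^{(I)}=\|B_{:,i}-Q_IQ_I^\top B_{:,i}\|^2$ for $i\in[n]$, sample $i$ with probability $d_i^{(I)}/\sum_{j}d_j^{(I)}$, and add $i$ to $I$ (stop if all $d_i^{(I)}$ vanish). The output is the final $I$. *)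

theory Defs
  imports "HOL-Analysis.Analysis" "HOL-Probability.Probability"
begin

text \<open>
  An \<open>N \<times> n\<close> matrix is an element of \<^typ>\<open>real^'n^'N\<close>; the library norm on this type is the
  Euclidean norm of the vector of row norms, that is, the Frobenius norm.
\<close>

text \<open>
  The submatrix of columns indexed by \<open>J\<close>, padded with zero columns so that the number of columns
  need not depend on \<open>J\<close>. In a product \<open>col_sub A J ** X\<close> the rows of \<open>X\<close> outside \<open>J\<close> are
  irrelevant, so that only the \<open>|J| \<times> n\<close> block of rows of \<open>X\<close> indexed by \<open>J\<close> matters.
\<close>

definition col_sub :: "real^'n^'m \<Rightarrow> 'n set \<Rightarrow> real^'n^'m" where
  "col_sub A J = (\<chi> i j. if j \<in> J then A $ i $ j else 0)"

lemma col_sub_mult: "(col_sub A J ** X) $ i $ l = (\<Sum>j\<in>J. A $ i $ j * X $ j $ l)"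
  by (simp add: col_sub_def matrix_matrix_mult_def if_distrib if_distribR sum.If_cases cong: if_cong)

definition subspace_embedding :: "real \<Rightarrow> real^'N^'m \<Rightarrow> real^'n^'N \<Rightarrow> bool" where
  "subspace_embedding \<delta> S A \<longleftrightarrow>
     (\<forall>x \<in> span (columns A).
        (1 - \<delta>) * (norm x)\<^sup>2 \<le> (norm (S *v x))\<^sup>2 \<and> (norm (S *v x))\<^sup>2 \<le> (1 + \<delta>) * (norm x)\<^sup>2)"

definition best_rank_approx :: "nat \<Rightarrow> real^'n^'m \<Rightarrow> real^'n^'m \<Rightarrow> bool" where
  "best_rank_approx r A B \<longleftrightarrow> is_arg_min (\<lambda>C. norm (A - C)) (\<lambda>C. rank C \<le> r) B"

text \<open>An orthonormal basis \<open>Q\<close> of a subspace is kept as the set of its vectors.\<close>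

definition orthonormal_basis_of :: "(real^'m) set \<Rightarrow> (real^'m) set \<Rightarrow> bool" where
  "orthonormal_basis_of V Q \<longleftrightarrow> pairwise orthogonal Q \<and> (\<forall>q\<in>Q. norm q = 1) \<and> span Q = V"

definition Q_of :: "real^'n^'m \<Rightarrow> 'n set \<Rightarrow> (real^'m) set" where
  "Q_of B I = (SOME Q. orthonormal_basis_of (span ((\<lambda>i. column i B) ` I)) Q)"

lemma Q_of: "orthonormal_basis_of (span ((\<lambda>i. column i B) ` I)) (Q_of B I)"
proof -
  obtain Q where "pairwise orthogonal Q" "\<And>q. q \<in> Q \<Longrightarrow> norm q = 1"
    "span Q = span ((\<lambda>i. column i B) ` I)"
    using orthonormal_basis_subspace[OF subspace_span, of "(\<lambda>i. column i B) ` I"] by metis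
  then have "\<exists>Q. orthonormal_basis_of (span ((\<lambda>i. column i B) ` I)) Q"
    by (auto simp: orthonormal_basis_of_def)
  then show ?thesis
    unfolding Q_of_def by (rule someI_ex)
qed

text \<open>With \<open>Q\<close> as a set of vectors, \<open>Q Q\<^sup>T b = (\<Sum>q\<in>Q. (q \<bullet> b) *\<^sub>R q)\<close>.\<close>

definition residual :: "real^'n^'m \<Rightarrow> 'n set \<Rightarrow> 'n \<Rightarrow> real" where
  "residual B I i =
     (norm (column i B - (\<Sum>q\<in>Q_of B I. (q \<bullet> column i B) *\<^sub>R q)))\<^sup>2"

definition pivot_pmf :: "real^'n^'m \<Rightarrow> 'n set \<Rightarrow> 'n pmf" where
  "pivot_pmf B I = embed_pmf (\<lambda>i. residual B I i / (\<Sum>j\<in>UNIV. residual B I j))"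

lemma residual_nonneg: "residual B I i \<ge> 0"
  by (simp add: residual_def)

lemma pmf_pivot_pmf:
  assumes "\<exists>i. residual B I i \<noteq> 0"
  shows "pmf (pivot_pmf B I) i = residual B I i / (\<Sum>j\<in>UNIV. residual B I j)"
  unfolding pivot_pmf_def
proof (rule pmf_embed_pmf)
  have pos: "(\<Sum>j\<in>UNIV. residual B I j) \<noteq> 0"
    using assms by (simp add: sum_nonneg_eq_0_iff residual_nonneg)
  show "0 \<le> residual B I x / (\<Sum>j\<in>UNIV. residual B I j)" for x
    by (simp add: residual_nonneg sum_nonneg)
  then show "(\<integral>\<^sup>+x. ennreal (residual B I x / (\<Sum>j\<in>UNIV. residual B I j)) \<partial>count_space UNIV) = 1"
    using pos by (simp add: nn_integral_count_space_finite flip: sum_divide_distrib)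
qed

text \<open>
  The law of the index set after \<open>k\<close> rounds. Stopping once all residuals vanish is rendered by
  leaving the index set unchanged in the remaining rounds.
\<close>

fun norm_sampling :: "nat \<Rightarrow> real^'n^'m \<Rightarrow> 'n set pmf" where
  "norm_sampling 0 B = return_pmf {}"
| "norm_sampling (Suc k) B =
     bind_pmf (norm_sampling k B)
       (\<lambda>I. if \<forall>i. residual B I i = 0 then return_pmf I
            else map_pmf (\<lambda>i. insert i I) (pivot_pmf B I))"

end

theory Submission
  imports Defs
begin

text \<open>
  Let \<open>R\<close> be the residual matrix of \<open>A\<close> after projecting out the columns chosen so far. Fix an
  orthonormal basis \<open>W\<close> of the row space of \<open>Ar\<close>, which has at most \<open>r\<close> elements, and put
  \<open>b = \<parallel>A - Ar\<parallel>\<^sup>2\<close>. Outside \<open>W\<close> the energy of \<open>A\<close>, hence of \<open>R\<close>, is at most \<open>b\<close>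
  (\<open>norm_residual_le_captured\<close>); so everything depends on the energy \<open>a = (\<Sum>w\<in>W. \<parallel>R w\<parallel>\<^sup>2)\<close>
  inside \<open>W\<close>.

  A pivot \<open>i\<close> with residual column \<open>r\<^sub>i\<close> lowers \<open>\<parallel>R w\<parallel>\<^sup>2\<close> by at least \<open>(r\<^sub>i \<bullet> R w)\<^sup>2 / \<parallel>r\<^sub>i\<parallel>\<^sup>2\<close>. The
  sketch distorts squared residuals by factors between \<open>1 - \<delta>\<close> and \<open>1 + \<delta>\<close>, so \<open>i\<close> is drawn
  with probability at least \<open>c \<parallel>r\<^sub>i\<parallel>\<^sup>2 / \<parallel>R\<parallel>\<^sup>2\<close>, where \<open>c = (1 - \<delta>) / (1 + \<delta>)\<close>. On average \<open>a\<close>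
  therefore drops by at least \<open>(c / r) a\<^sup>2 / (a + b)\<close> (\<open>expected_captured_insert\<close>). This is
  convex in \<open>a\<close>, so by Jensen the expectations \<open>m\<close> of \<open>a\<close> obey the same recursion, and
  \<open>b / m - ln m\<close> grows by at least \<open>c / r\<close> per round. After the required number of rounds
  \<open>m \<le> \<epsilon> b\<close> (\<open>recursion_bound\<close>), which gives the first claim. Working in the row space of \<open>Ar\<close>
  replaces the analysis of the whole spectrum of \<open>R\<^sup>T R\<close> by a recursion for one real number.

  If \<open>b = 0\<close> the recursion never reaches \<open>0\<close>, but \<open>A\<close> then has rank at most \<open>r \<le> k\<close>, and \<open>k\<close>
  independent columns exhaust its column space (\<open>residual_matrix_zero_of_small_rank\<close>).

  For the second claim the loss from solving the sketched problem is at most the factor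
  \<open>1 / (1 - \<delta>\<^sup>2) \<le> 1 / (1 - \<delta>)\<close> for each index set (\<open>sketched_least_squares\<close>). Applying the
  embedding separately to the two errors would not suffice; the normal equations of the
  sketched problem have to be used.
\<close>

section \<open>Matrices by columns\<close>

lemma norm_matrix_rows:
  fixes M :: "real^'n^'m"
  shows "(norm M)\<^sup>2 = (\<Sum>k\<in>UNIV. (norm (M $ k))\<^sup>2)"
  by (simp add: norm_vec_def L2_set_def sum_nonneg)

lemma inner_matrix_columns:
  fixes M P :: "real^'n^'m"
  shows "M \<bullet> P = (\<Sum>i\<in>UNIV. column i M \<bullet> column i P)"
  unfolding inner_vec_def column_def by (subst sum.swap) simp

lemma norm_matrix_columns:
  fixes M :: "real^'n^'m"
  shows "(norm M)\<^sup>2 = (\<Sum>i\<in>UNIV. (norm (column i M))\<^sup>2)"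
  by (simp add: power2_norm_eq_inner inner_matrix_columns)

lemma column_matrix_mult:
  fixes A :: "real^'n^'m" and B :: "real^'p^'n"
  shows "column i (A ** B) = A *v column i B"
  by (simp add: column_def matrix_matrix_mult_def matrix_vector_mult_def vec_eq_iff)

lemma matrix_vector_mult_columns:
  fixes A :: "real^'n^'m"
  shows "A *v x = (\<Sum>i\<in>UNIV. x $ i *\<^sub>R column i A)"
  by (simp add: matrix_mult_sum scalar_mult_eq_scaleR)

lemma column_minus:
  fixes A B :: "real^'n^'m"
  shows "column i (A - B) = column i A - column i B"
  by (simp add: column_def vec_eq_iff)

lemma matrix_mult_diff_right:
  fixes A :: "real^'n^'m" and B C :: "real^'p^'n"
  shows "A ** (B - C) = A ** B - A ** C"
  by (simp add: matrix_matrix_mult_def vec_eq_iff right_diff_distrib sum_subtractf)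

lemma matrix_mult_scaleR_right:
  fixes A :: "real^'n^'m" and B :: "real^'p^'n"
  shows "A ** (t *\<^sub>R B) = t *\<^sub>R (A ** B)"
  by (simp add: matrix_matrix_mult_def vec_eq_iff sum_distrib_left mult.left_commute)

section \<open>Residual matrices\<close>

lemma orthonormal_basis_finite:
  fixes Q :: "(real^'m) set"
  assumes "orthonormal_basis_of V Q"
  shows "finite Q"
proof -
  have "pairwise orthogonal Q" "0 \<notin> Q"
    using assms by (auto simp: orthonormal_basis_of_def)
  then show ?thesis
    by (intro independent_imp_finite pairwise_orthogonal_independent)
qed

lemma orthonormal_basis_residual:
  fixes Q :: "(real^'m) set"
  assumes "orthonormal_basis_of V Q"
  shows "(\<Sum>q\<in>Q. (q \<bullet> y) *\<^sub>R q) \<in> V"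
    and "v \<in> V \<Longrightarrow> (y - (\<Sum>q\<in>Q. (q \<bullet> y) *\<^sub>R q)) \<bullet> v = 0"
proof -
  note Q = assms[unfolded orthonormal_basis_of_def]
  note fin = orthonormal_basis_finite[OF assms]
  have "(\<Sum>q\<in>Q. (q \<bullet> y) *\<^sub>R q) \<in> span Q"
    by (intro span_sum span_scale span_base)
  then show "(\<Sum>q\<in>Q. (q \<bullet> y) *\<^sub>R q) \<in> V"
    using Q by simp
  have base: "(y - (\<Sum>q\<in>Q. (q \<bullet> y) *\<^sub>R q)) \<bullet> p = 0" if "p \<in> Q" for p
  proof -
    have "(\<Sum>q\<in>Q. (q \<bullet> y) *\<^sub>R q) \<bullet> p = (\<Sum>q\<in>Q. if q = p then p \<bullet> y else 0)"
      unfolding inner_sum_left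
      using Q that by (intro sum.cong) (auto simp: pairwise_def orthogonal_def norm_eq_1)
    then show ?thesis
      using fin that by (simp add: inner_diff_left inner_commute[of p])
  qed
  assume "v \<in> V"
  then have "v \<in> span Q"
    using Q by simp
  then show "(y - (\<Sum>q\<in>Q. (q \<bullet> y) *\<^sub>R q)) \<bullet> v = 0"
    by (induction rule: span_induct_alt) (auto simp: inner_add_right base)
qed

text \<open>
  The matrix \<open>(I - Q Q\<^sup>T) B\<close>, where \<open>Q\<close> spans the columns chosen so far. Carrying the residual
  as one matrix, instead of one number per column, lets it be tested against arbitrary row
  directions.
\<close>

definition residual_matrix :: "real^'n^'m \<Rightarrow> 'n set \<Rightarrow> real^'n^'m" where
  "residual_matrix B I =
     (\<chi> k i. (column i B - (\<Sum>q\<in>Q_of B I. (q \<bullet> column i B) *\<^sub>R q)) $ k)"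

lemma column_residual_matrix:
  "column i (residual_matrix B I) =
     column i B - (\<Sum>q\<in>Q_of B I. (q \<bullet> column i B) *\<^sub>R q)"
  by (subst column_def) (simp add: residual_matrix_def vec_eq_iff)

lemma residual_eq_norm_column:
  "residual B I i = (norm (column i (residual_matrix B I)))\<^sup>2"
  by (simp add: residual_def column_residual_matrix)

lemma sum_residual: "(\<Sum>i\<in>UNIV. residual B I i) = (norm (residual_matrix B I))\<^sup>2"
  by (simp add: residual_eq_norm_column norm_matrix_columns)

lemma residual_matrix_orthogonal:
  assumes "v \<in> span ((\<lambda>i. column i B) ` I)"
  shows "(residual_matrix B I *v x) \<bullet> v = 0"
proof -
  have "column i (residual_matrix B I) \<bullet> v = 0" for i
    using orthonormal_basis_residual(2)[OF Q_of assms]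
    by (simp add: column_residual_matrix)
  then show ?thesis
    by (simp add: matrix_vector_mult_columns inner_sum_left)
qed

lemma residual_matrix_diff_in_span:
  "B *v x - residual_matrix B I *v x \<in> span ((\<lambda>i. column i B) ` I)"
proof -
  have "column i B - column i (residual_matrix B I) \<in> span ((\<lambda>i. column i B) ` I)" for i
    using orthonormal_basis_residual(1)[OF Q_of, of "column i B" B I]
    by (simp add: column_residual_matrix)
  then show ?thesis
    by (simp add: matrix_vector_mult_columns flip: sum_subtractf scaleR_diff_right)
      (intro span_sum span_scale)
qed

text \<open>
  Projection is best approximation: the competing error is the residual plus a vector of the
  span, and Pythagoras applies.
\<close>

lemma residual_matrix_minimal:
  assumes "v \<in> span ((\<lambda>i. column i B) ` I)"
  shows "norm (residual_matrix B I *v x) \<le> norm (B *v x - v)"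
proof -
  let ?z = "residual_matrix B I *v x"
  define u where "u = B *v x - ?z - v"
  have "u \<in> span ((\<lambda>i. column i B) ` I)"
    unfolding u_def using assms residual_matrix_diff_in_span by (rule span_diff[rotated])
  then have "?z \<bullet> u = 0"
    by (rule residual_matrix_orthogonal)
  then have "(norm (?z + u))\<^sup>2 = (norm ?z)\<^sup>2 + (norm u)\<^sup>2"
    by (simp add: power2_norm_eq_inner inner_add_left inner_add_right inner_commute)
  moreover have "?z + u = B *v x - v"
    by (simp add: u_def)
  ultimately show ?thesis
    by (metis le_add_same_cancel1 norm_ge_zero power2_le_imp_le zero_le_power2)
qed

lemma residual_zero_iff:
  "residual B I i = 0 \<longleftrightarrow> column i B \<in> span ((\<lambda>i. column i B) ` I)"
proof
  assume "residual B I i = 0"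
  then show "column i B \<in> span ((\<lambda>i. column i B) ` I)"
    using residual_matrix_diff_in_span[of B "axis i 1" I]
    by (simp add: residual_eq_norm_column matrix_vector_mult_basis)
next
  assume "column i B \<in> span ((\<lambda>i. column i B) ` I)"
  from residual_matrix_minimal[OF this, of "axis i 1"]
  show "residual B I i = 0"
    by (simp add: residual_eq_norm_column matrix_vector_mult_basis)
qed

section \<open>Column subsets and least squares\<close>

lemma col_sub_mult_vec:
  fixes A :: "real^'n^'m"
  shows "col_sub A J *v x = (\<Sum>j\<in>J. x $ j *\<^sub>R column j A)"
  by (simp add: col_sub_def matrix_vector_mult_def vec_eq_iff column_def if_distrib if_distribR
      sum.If_cases mult.commute cong: if_cong)

lemma col_sub_mult_vec_in_span:
  fixes A :: "real^'n^'m"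
  shows "col_sub A J *v x \<in> span ((\<lambda>i. column i A) ` J)"
  unfolding col_sub_mult_vec by (intro span_sum span_scale span_base) auto

text \<open>
  A chosen column is the image of a coordinate vector, so the range of \<open>col_sub A J\<close> is a
  subspace that contains the generators of the span.
\<close>

lemma col_sub_surj:
  fixes A :: "real^'n^'m"
  assumes "v \<in> span ((\<lambda>i. column i A) ` J)"
  obtains x where "v = col_sub A J *v x"
proof -
  have "v \<in> range (\<lambda>x. col_sub A J *v x)"
  proof (rule set_mp[OF span_minimal assms])
    show "(\<lambda>i. column i A) ` J \<subseteq> range ((*v) (col_sub A J))"
    proof safe
      fix j assume "j \<in> J"
      then have "column j A = col_sub A J *v axis j 1"
        by (simp add: matrix_vector_mult_basis) (simp add: col_sub_def column_def)
      then show "column j A \<in> range ((*v) (col_sub A J))"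
        by blast
    qed
    show "subspace (range ((*v) (col_sub A J)))"
      by (simp add: linear_subspace_image)
  qed
  then show thesis
    using that by blast
qed

text \<open>
  The residual matrix is itself an error of the form \<open>A - A\<^sub>J X\<close>. This is how the bounds on the
  residual matrix reach the least-squares problems of the theorem.
\<close>

lemma residual_matrix_eq_col_sub:
  fixes A :: "real^'n^'m"
  obtains X :: "real^'n^'n" where "residual_matrix A J = A - col_sub A J ** X"
proof -
  have "\<forall>i. \<exists>x. column i A - column i (residual_matrix A J) = col_sub A J *v x"
    using residual_matrix_diff_in_span[of A "axis _ 1" J] col_sub_surj
    unfolding matrix_vector_mult_basis by metis
  then obtain x where x: "\<And>i. column i A - column i (residual_matrix A J) = col_sub A J *v x i"
    by metis
  define X :: "real^'n^'n" where "X = (\<chi> j i. x i $ j)"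
  have "column i X = x i" for i
    by (simp add: X_def column_def)
  then have "column i (residual_matrix A J) = column i (A - col_sub A J ** X)" for i
    using x[of i] by (simp add: column_minus column_matrix_mult algebra_simps)
  then have "residual_matrix A J = A - col_sub A J ** X"
    by (auto simp: column_def vec_eq_iff)
  then show thesis
    using that by blast
qed

lemma col_sub_matrix_mult: "col_sub (S ** A) J = S ** col_sub A J"
  by (simp add: col_sub_def matrix_matrix_mult_def vec_eq_iff)

lemma col_sub_eq_matrix_mult:
  fixes A :: "real^'n^'m"
  shows "col_sub A J = A ** col_sub (mat 1) J"
  using col_sub_matrix_mult[of A "mat 1" J] by simp

lemma INF_col_sub_le:
  fixes A :: "real^'n^'m"
  shows "(INF X :: real^'n^'n. (norm (A - col_sub A J ** X))\<^sup>2) \<le> (norm (residual_matrix A J))\<^sup>2"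
proof -
  obtain X :: "real^'n^'n" where X: "residual_matrix A J = A - col_sub A J ** X"
    by (rule residual_matrix_eq_col_sub)
  have "bdd_below (range (\<lambda>X :: real^'n^'n. (norm (A - col_sub A J ** X))\<^sup>2))"
    by (rule bdd_belowI[of _ 0]) auto
  then show ?thesis
    unfolding X by (rule cINF_lower) simp
qed

section \<open>Subspace embeddings\<close>

lemma subspace_embedding_mult_vec:
  fixes A :: "real^'n^'N" and S :: "real^'N^'m"
  assumes "subspace_embedding \<delta> S A"
  shows "(1 - \<delta>) * (norm (A *v x))\<^sup>2 \<le> (norm ((S ** A) *v x))\<^sup>2"
    and "(norm ((S ** A) *v x))\<^sup>2 \<le> (1 + \<delta>) * (norm (A *v x))\<^sup>2"
  using assms matrix_vector_mult_in_columnspace[of A x]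
  by (auto simp: subspace_embedding_def simp flip: matrix_vector_mul_assoc)

lemma subspace_embedding_matrix_mult:
  fixes A :: "real^'n^'N" and S :: "real^'N^'m" and C :: "real^'p^'n"
  assumes "subspace_embedding \<delta> S A"
  shows "(1 - \<delta>) * (norm (A ** C))\<^sup>2 \<le> (norm (S ** (A ** C)))\<^sup>2"
    and "(norm (S ** (A ** C)))\<^sup>2 \<le> (1 + \<delta>) * (norm (A ** C))\<^sup>2"
  unfolding matrix_mul_assoc norm_matrix_columns column_matrix_mult sum_distrib_left
  by (intro sum_mono subspace_embedding_mult_vec[OF assms])+

text \<open>
  Both residuals are minima, over the same coefficient vectors \<open>y\<close>, of the norms of \<open>A z\<close> and
  of \<open>S A z\<close> for \<open>z = e\<^sub>i - y\<close>. The embedding compares these norms for each \<open>z\<close>, so it suffices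
  to insert the minimiser of one problem as a candidate into the other. Consequently the
  sketched pivot probabilities lose at most a factor \<open>(1 - \<delta>) / (1 + \<delta>)\<close> against the
  unsketched ones.
\<close>

lemma residual_sketch:
  fixes A :: "real^'n^'N" and S :: "real^'N^'m"
  assumes SE: "subspace_embedding \<delta> S A" and "\<delta> < 1"
  shows "(1 - \<delta>) * residual A I i \<le> residual (S ** A) I i"
    and "residual (S ** A) I i \<le> (1 + \<delta>) * residual A I i"
proof -
  let ?a = "axis i 1 :: real^'n"
  have res: "residual B I i = (norm (residual_matrix B I *v ?a))\<^sup>2" for B :: "real^'n^'l"
    by (simp add: residual_eq_norm_column matrix_vector_mult_basis)
  have sub: "B *v x - col_sub B I *v y = B *v (x - col_sub (mat 1) I *v y)"
    for B :: "real^'n^'l" and x y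
    by (subst col_sub_eq_matrix_mult)
      (simp add: matrix_vector_mult_diff_distrib matrix_vector_mul_assoc)
  have opt: "\<exists>y. residual B I i = (norm (B *v ?a - col_sub B I *v y))\<^sup>2" for B :: "real^'n^'l"
  proof -
    obtain y where "B *v ?a - residual_matrix B I *v ?a = col_sub B I *v y"
      using residual_matrix_diff_in_span col_sub_surj by metis
    then have "residual_matrix B I *v ?a = B *v ?a - col_sub B I *v y"
      by (simp add: algebra_simps)
    then show ?thesis
      using res by metis
  qed
  have min: "residual B I i \<le> (norm (B *v ?a - col_sub B I *v y))\<^sup>2" for B :: "real^'n^'l" and y
    unfolding res by (intro power_mono residual_matrix_minimal col_sub_mult_vec_in_span) simp
  obtain y where y: "residual (S ** A) I i = (norm ((S ** A) *v ?a - col_sub (S ** A) I *v y))\<^sup>2"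
    using opt by blast
  have "(1 - \<delta>) * residual A I i \<le> (1 - \<delta>) * (norm (A *v ?a - col_sub A I *v y))\<^sup>2"
    using \<open>\<delta> < 1\<close> by (intro mult_left_mono min) simp
  also have "\<dots> \<le> residual (S ** A) I i"
    unfolding y sub by (rule subspace_embedding_mult_vec[OF SE])
  finally show "(1 - \<delta>) * residual A I i \<le> residual (S ** A) I i" .
  obtain z where z: "residual A I i = (norm (A *v ?a - col_sub A I *v z))\<^sup>2"
    using opt by blast
  show "residual (S ** A) I i \<le> (1 + \<delta>) * residual A I i"
    using min[of "S ** A" z] subspace_embedding_mult_vec(2)[OF SE] unfolding z sub
    by (rule order_trans)
qed

section \<open>One pivoting step\<close>

text \<open>
  After \<open>i\<close> is added, the span contains the residual column \<open>r = R e\<^sub>i\<close>, so the new residual of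
  \<open>A x\<close> is no longer than \<open>R x\<close> with its component along \<open>r\<close> removed. For \<open>r = 0\<close> the
  subtracted quotient is \<open>0\<close>, and the bound says only that residuals do not grow.
\<close>

lemma residual_matrix_insert:
  fixes A :: "real^'n^'m" and I :: "'n set"
  defines "R \<equiv> residual_matrix A I"
  shows "(norm (residual_matrix A (insert i I) *v x))\<^sup>2
           \<le> (norm (R *v x))\<^sup>2 - (column i R \<bullet> (R *v x))\<^sup>2 / (norm (column i R))\<^sup>2"
proof -
  define V where "V = span ((\<lambda>j. column j A) ` insert i I)"
  define t where "t = (column i R \<bullet> (R *v x)) / (norm (column i R))\<^sup>2"
  have "span ((\<lambda>j. column j A) ` I) \<subseteq> V"
    unfolding V_def by (intro span_mono) auto
  then have in_V: "A *v y - R *v y \<in> V" for y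
    using residual_matrix_diff_in_span unfolding R_def by blast
  have "column i A \<in> V"
    unfolding V_def by (intro span_base) auto
  moreover have "column i A - column i R \<in> V"
    using in_V[of "axis i 1"] by (simp add: matrix_vector_mult_basis)
  ultimately have "column i A - (column i A - column i R) \<in> V"
    unfolding V_def by (rule span_diff)
  then have "column i R \<in> V"
    by simp
  then have "(A *v x - R *v x) + t *\<^sub>R column i R \<in> V"
    using in_V unfolding V_def by (intro span_add span_scale)
  from residual_matrix_minimal[OF this[unfolded V_def], of x]
  have "norm (residual_matrix A (insert i I) *v x) \<le> norm (R *v x - t *\<^sub>R column i R)"
    by (simp add: algebra_simps)
  then have "(norm (residual_matrix A (insert i I) *v x))\<^sup>2 \<le> (norm (R *v x - t *\<^sub>R column i R))\<^sup>2"
    by (rule power_mono) simp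
  also have "\<dots> = (norm (R *v x))\<^sup>2 - 2 * t * (column i R \<bullet> (R *v x)) + t\<^sup>2 * (norm (column i R))\<^sup>2"
    unfolding power2_norm_eq_inner
    by (simp add: inner_diff_left inner_diff_right inner_commute[of "R *v x" "column i R"]
        power2_eq_square right_diff_distrib)
  also have "\<dots> = (norm (R *v x))\<^sup>2 - (column i R \<bullet> (R *v x))\<^sup>2 / (norm (column i R))\<^sup>2"
    by (cases "column i R = 0") (simp_all add: t_def power2_eq_square)
  finally show ?thesis .
qed

text \<open>
  For orthonormal \<open>W\<close> this is \<open>\<parallel>M P\<parallel>\<^sup>2\<close> with \<open>P\<close> the orthogonal projection onto the span of
  \<open>W\<close>: the part of the energy of \<open>M\<close> that lies in the row directions \<open>W\<close>.
\<close>

definition captured :: "(real^'n) set \<Rightarrow> real^'n^'m \<Rightarrow> real" where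
  "captured W M = (\<Sum>w\<in>W. (norm (M *v w))\<^sup>2)"

lemma captured_nonneg: "0 \<le> captured W M"
  by (simp add: captured_def sum_nonneg)

text \<open>
  In terms of the Gram matrix \<open>G = R\<^sup>T R\<close> this is \<open>(w \<bullet> G w)\<^sup>2 \<le> \<parallel>G w\<parallel>\<^sup>2\<close> for a unit vector \<open>w\<close>.
\<close>

lemma quartic_le_gram:
  fixes R :: "real^'n^'m"
  assumes "norm w = 1"
  shows "((norm (R *v w))\<^sup>2)\<^sup>2 \<le> (\<Sum>i\<in>UNIV. (column i R \<bullet> (R *v w))\<^sup>2)"
proof -
  have "(norm (R *v w))\<^sup>2 = (\<Sum>i\<in>UNIV. w $ i * (column i R \<bullet> (R *v w)))"
    unfolding power2_norm_eq_inner by (subst (1) matrix_vector_mult_columns) (simp add: inner_sum_left)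
  then have "((norm (R *v w))\<^sup>2)\<^sup>2
      \<le> (\<Sum>i\<in>UNIV. (w $ i)\<^sup>2) * (\<Sum>i\<in>UNIV. (column i R \<bullet> (R *v w))\<^sup>2)"
    by (simp add: Cauchy_Schwarz_ineq_sum)
  moreover have "(\<Sum>i\<in>UNIV. (w $ i)\<^sup>2) = 1"
    using assms by (simp add: norm_vec_def L2_set_def)
  ultimately show ?thesis
    by simp
qed

text \<open>
  The key estimate. The drop in direction \<open>w\<close> for pivot \<open>i\<close> is \<open>(r\<^sub>i \<bullet> R w)\<^sup>2 / \<parallel>r\<^sub>i\<parallel>\<^sup>2\<close>, and
  sampling with probability about \<open>\<parallel>r\<^sub>i\<parallel>\<^sup>2 / \<parallel>R\<parallel>\<^sup>2\<close> cancels the denominator. What remains is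
  \<open>\<parallel>R\<^sup>T R w\<parallel>\<^sup>2 / \<parallel>R\<parallel>\<^sup>2\<close>, which is at least \<open>\<parallel>R w\<parallel>\<^sup>4 / \<parallel>R\<parallel>\<^sup>2\<close>. Summing the fourth powers over the at
  most \<open>r\<close> directions in \<open>W\<close> costs a factor \<open>r\<close> by Cauchy-Schwarz.
\<close>

lemma expected_captured_insert:
  fixes A :: "real^'n^'m" and p :: "'n \<Rightarrow> real" and I :: "'n set"
  defines "R \<equiv> residual_matrix A I"
  assumes unit: "\<And>w. w \<in> W \<Longrightarrow> norm w = 1" and card: "card W \<le> r" "0 < r"
    and p: "\<And>i. c * (norm (column i R))\<^sup>2 / (norm R)\<^sup>2 \<le> p i" "sum p UNIV = 1" and "0 \<le> c"
  shows "(\<Sum>i\<in>UNIV. p i * captured W (residual_matrix A (insert i I)))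
           \<le> captured W R - c / real r * (captured W R)\<^sup>2 / (norm R)\<^sup>2"
proof -
  have p_nonneg: "0 \<le> p i" for i
    by (rule order_trans[OF _ p(1)]) (use \<open>0 \<le> c\<close> in simp)
  define g where "g i w = (column i R \<bullet> (R *v w))\<^sup>2" for i w
  have "(\<Sum>i\<in>UNIV. p i * captured W (residual_matrix A (insert i I)))
      \<le> (\<Sum>i\<in>UNIV. p i * (\<Sum>w\<in>W. (norm (R *v w))\<^sup>2 - g i w / (norm (column i R))\<^sup>2))"
    unfolding captured_def g_def R_def
    by (intro sum_mono mult_left_mono residual_matrix_insert p_nonneg)
  also have "\<dots> = captured W R - (\<Sum>i\<in>UNIV. \<Sum>w\<in>W. p i * (g i w / (norm (column i R))\<^sup>2))"
  proof -
    have "(\<Sum>i\<in>UNIV. p i * captured W R) = captured W R"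
      using p(2) by (metis mult_1 sum_distrib_right)
    then show ?thesis
      by (simp add: captured_def sum_subtractf right_diff_distrib)
        (simp add: sum_distrib_left)
  qed
  also have "\<dots> \<le> captured W R - (\<Sum>i\<in>UNIV. \<Sum>w\<in>W. c * g i w / (norm R)\<^sup>2)"
  proof (intro diff_left_mono sum_mono)
    fix i w
    show "c * g i w / (norm R)\<^sup>2 \<le> p i * (g i w / (norm (column i R))\<^sup>2)"
    proof (cases "column i R = 0")
      case True
      then show ?thesis by (simp add: g_def)
    next
      case False
      have "c * (norm (column i R))\<^sup>2 / (norm R)\<^sup>2 * (g i w / (norm (column i R))\<^sup>2)
          \<le> p i * (g i w / (norm (column i R))\<^sup>2)"
        by (intro mult_right_mono p) (simp add: g_def)
      with False show ?thesis by simp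
    qed
  qed
  also have "(\<Sum>i\<in>UNIV. \<Sum>w\<in>W. c * g i w / (norm R)\<^sup>2) = c / (norm R)\<^sup>2 * (\<Sum>w\<in>W. \<Sum>i\<in>UNIV. g i w)"
    by (subst sum.swap) (simp add: sum_distrib_left)
  also have "captured W R - c / (norm R)\<^sup>2 * (\<Sum>w\<in>W. \<Sum>i\<in>UNIV. g i w)
      \<le> captured W R - c / (norm R)\<^sup>2 * ((captured W R)\<^sup>2 / real r)"
  proof (intro diff_left_mono mult_left_mono)
    have "(captured W R)\<^sup>2 \<le> (\<Sum>w\<in>W. ((norm (R *v w))\<^sup>2)\<^sup>2) * real (card W)"
      unfolding captured_def by (rule sum_squared_le_sum_of_squares)
    also have "\<dots> \<le> (\<Sum>w\<in>W. ((norm (R *v w))\<^sup>2)\<^sup>2) * real r"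
      using card by (intro mult_left_mono sum_nonneg) auto
    also have "\<dots> \<le> (\<Sum>w\<in>W. \<Sum>i\<in>UNIV. g i w) * real r"
      unfolding g_def using unit by (intro mult_right_mono sum_mono quartic_le_gram) auto
    finally show "(captured W R)\<^sup>2 / real r \<le> (\<Sum>w\<in>W. \<Sum>i\<in>UNIV. g i w)"
      using card by (simp add: field_simps)
  qed (use \<open>0 \<le> c\<close> in simp)
  finally show ?thesis
    by (simp add: field_simps)
qed

section \<open>Splitting the residual along a row space\<close>

lemma orthonormal_parseval:
  fixes x :: "real^'n"
  assumes "orthonormal_basis_of UNIV E"
  shows "(\<Sum>e\<in>E. (e \<bullet> x)\<^sup>2) = (norm x)\<^sup>2"
proof -
  have "(x - (\<Sum>q\<in>E. (q \<bullet> x) *\<^sub>R q)) \<bullet> (x - (\<Sum>q\<in>E. (q \<bullet> x) *\<^sub>R q)) = 0"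
    using orthonormal_basis_residual(2)[OF assms] by blast
  then have x: "x = (\<Sum>q\<in>E. (q \<bullet> x) *\<^sub>R q)"
    by simp
  have "x \<bullet> x = (\<Sum>q\<in>E. (q \<bullet> x) *\<^sub>R q) \<bullet> x"
    using x by simp
  then show ?thesis
    unfolding power2_norm_eq_inner by (simp add: inner_sum_left power2_eq_square)
qed

text \<open>
  Frobenius norms do not depend on the orthonormal basis in which the rows are expanded.
\<close>

lemma captured_orthonormal_basis:
  fixes M :: "real^'n^'m"
  assumes "orthonormal_basis_of UNIV E"
  shows "captured E M = (norm M)\<^sup>2"
proof -
  have "captured E M = (\<Sum>k\<in>UNIV. \<Sum>e\<in>E. (e \<bullet> M $ k)\<^sup>2)"
    unfolding captured_def
    by (subst sum.swap) (simp add: norm_vec_def L2_set_def sum_nonneg matrix_vector_mul_component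
        inner_commute)
  then show ?thesis
    by (simp add: orthonormal_parseval[OF assms] norm_matrix_rows)
qed

text \<open>
  An orthonormal basis adapted to \<open>C\<close>: \<open>W\<close> spans the row space and \<open>W'\<close> its orthogonal
  complement, which is the kernel.
\<close>

lemma row_space_basis:
  fixes C :: "real^'n^'m"
  obtains W W' where "orthonormal_basis_of UNIV (W \<union> W')" "W \<inter> W' = {}" "card W = rank C"
    "\<And>w. w \<in> W' \<Longrightarrow> C *v w = 0"
proof -
  let ?U = "span (rows C)"
  obtain W where W: "W \<subseteq> ?U" "pairwise orthogonal W" "\<And>x. x \<in> W \<Longrightarrow> norm x = 1"
    "card W = dim ?U" "span W = ?U"
    by (rule orthonormal_basis_subspace[OF subspace_span, of "rows C"]) blast
  have "subspace {y. \<forall>x\<in>?U. orthogonal x y}"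
    by (auto simp: subspace_def orthogonal_clauses)
  then obtain W' where W': "W' \<subseteq> {y. \<forall>x\<in>?U. orthogonal x y}" "pairwise orthogonal W'"
    "\<And>x. x \<in> W' \<Longrightarrow> norm x = 1" "span W' = {y. \<forall>x\<in>?U. orthogonal x y}"
    by (rule orthonormal_basis_subspace) blast
  have orth: "orthogonal x y" if "x \<in> W" "y \<in> W'" for x y
    using that W W' by blast
  have "pairwise orthogonal (W \<union> W')"
    using orth W(2) W'(2) orthogonal_commute unfolding pairwise_def by (metis UnE)
  moreover have "x \<in> span (W \<union> W')" for x
  proof -
    obtain y z where "y \<in> ?U" "\<And>w. w \<in> ?U \<Longrightarrow> orthogonal z w" "x = y + z"
      by (rule orthogonal_subspace_decomp_exists[of "rows C" x]) blast
    then have "y \<in> span W" "z \<in> span W'" "x = y + z"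
      using W W' by (auto simp: orthogonal_commute)
    moreover from this have "y \<in> span (W \<union> W')" "z \<in> span (W \<union> W')"
      using span_mono[of W "W \<union> W'"] span_mono[of W' "W \<union> W'"] by auto
    ultimately show ?thesis
      by (simp add: span_add)
  qed
  ultimately have "orthonormal_basis_of UNIV (W \<union> W')"
    using W(3) W'(3) by (auto simp: orthonormal_basis_of_def)
  moreover have "W \<inter> W' = {}"
  proof (rule ccontr)
    assume "W \<inter> W' \<noteq> {}"
    then obtain x where "x \<in> W" "x \<in> W'" by blast
    then have "x = 0"
      using orth orthogonal_self by blast
    with W(3) \<open>x \<in> W\<close> show False by force
  qed
  moreover have "card W = rank C"
    using W(4) by (simp add: row_rank_def)
  moreover have "C *v w = 0" if "w \<in> W'" for w
  proof -
    have "C $ k \<bullet> w = 0" for k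
    proof -
      have "C $ k \<in> ?U"
        by (intro span_base) (auto simp: rows_def row_def)
      then show ?thesis
        using that W'(1) by (auto simp: orthogonal_def)
    qed
    then show ?thesis
      by (simp add: vec_eq_iff matrix_vector_mul_component)
  qed
  ultimately show thesis
    using that by blast
qed

text \<open>
  In the kernel directions \<open>W'\<close> the matrices \<open>A\<close> and \<open>A - C\<close> agree, so there the energy of
  \<open>A\<close>, and a fortiori that of a residual of \<open>A\<close>, is bounded by \<open>\<parallel>A - C\<parallel>\<^sup>2\<close>. Thus only the
  energy in the row space of \<open>C\<close> can be large, and sampling must reduce it.
\<close>

lemma norm_residual_le_captured:
  fixes A C :: "real^'n^'m"
  assumes E: "orthonormal_basis_of UNIV (W \<union> W')" "W \<inter> W' = {}"
    and ker: "\<And>w. w \<in> W' \<Longrightarrow> C *v w = 0"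
  shows "(norm (residual_matrix A I))\<^sup>2 \<le> captured W (residual_matrix A I) + (norm (A - C))\<^sup>2"
proof -
  have fin: "finite W" "finite W'"
    using orthonormal_basis_finite[OF E(1)] by auto
  have split: "(norm M)\<^sup>2 = captured W M + captured W' M" for M :: "real^'n^'m"
    unfolding captured_orthonormal_basis[OF E(1), symmetric] captured_def
    by (rule sum.union_disjoint[OF fin E(2)])
  have "captured W' (residual_matrix A I) \<le> captured W' (A - C)"
    unfolding captured_def
  proof (intro sum_mono power_mono)
    fix w assume "w \<in> W'"
    then show "norm (residual_matrix A I *v w) \<le> norm ((A - C) *v w)"
      using residual_matrix_minimal[OF span_zero, of A I w] ker
      by (simp add: matrix_vector_mult_diff_rdistrib)
  qed simp
  also have "\<dots> \<le> (norm (A - C))\<^sup>2"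
    using captured_nonneg[of W "A - C"] by (simp add: split)
  finally show ?thesis
    by (simp add: split)
qed

section \<open>The scalar recursion\<close>

text \<open>
  The convex function \<open>x\<^sup>2 / (x + b)\<close> lies above its tangent at \<open>m\<close>. Taking \<open>m\<close> to be a mean,
  this is Jensen's inequality in the form in which it is used below.
\<close>

lemma square_over_shift_tangent:
  fixes x m b :: real
  assumes "0 \<le> x" "0 \<le> m" "0 < b"
  shows "m\<^sup>2 / (m + b) + (1 - b\<^sup>2 / (m + b)\<^sup>2) * (x - m) \<le> x\<^sup>2 / (x + b)"
proof -
  \<comment> \<open>In the shifted variable the function is linear plus \<open>b\<^sup>2 / X\<close>, whose tangent defect is a square.\<close>
  define M X where "M = m + b" and "X = x + b"
  have pos: "0 < M" "0 < X"
    using assms by (auto simp: M_def X_def)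
  have sq: "(y - b)\<^sup>2 / y = y - 2 * b + b\<^sup>2 / y" if "0 < y" for y
    using that by (simp add: field_simps power2_eq_square)
  have "0 \<le> (b * (X - M))\<^sup>2 / (X * M\<^sup>2)"
    using pos by simp
  also have "\<dots> = b\<^sup>2 / X - b\<^sup>2 / M + b\<^sup>2 / M\<^sup>2 * (X - M)"
    using pos by (simp add: field_simps power2_eq_square)
  finally have "(M - b)\<^sup>2 / M + (1 - b\<^sup>2 / M\<^sup>2) * (X - M) \<le> (X - b)\<^sup>2 / X"
    unfolding sq[OF pos(1)] sq[OF pos(2)] by (simp add: algebra_simps)
  then show ?thesis
    by (simp add: M_def X_def)
qed

text \<open>
  Discrete version of the differential inequality \<open>m' \<le> - \<gamma> m\<^sup>2 / (m + b)\<close>. Separating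
  variables suggests the potential \<open>h = b / m - ln m\<close>, whose derivative in \<open>m\<close> is
  \<open>- (m + b) / m\<^sup>2\<close>; since \<open>h\<close> is convex and decreasing, a discrete step raises it by at least
  \<open>\<gamma>\<close> as well. As long as \<open>m\<close> exceeds \<open>\<epsilon> b\<close>, \<open>h\<close> stays below \<open>1 / \<epsilon> - ln (\<epsilon> b)\<close>, while it
  starts at \<open>- ln M\<close> or above. This limits the number of such steps.
\<close>

lemma recursion_bound:
  fixes m :: "nat \<Rightarrow> real"
  assumes step: "\<And>t. m (Suc t) \<le> m t - \<gamma> * ((m t)\<^sup>2 / (m t + b))"
    and "0 \<le> \<gamma>" "0 < b" "0 < \<epsilon>" and nonneg: "\<And>t. 0 \<le> m t" and "m 0 \<le> M" "0 < M"
    and k: "1 / \<epsilon> + ln (M / (\<epsilon> * b)) \<le> \<gamma> * real k"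
  shows "m k \<le> \<epsilon> * b"
proof (rule ccontr)
  assume "\<not> m k \<le> \<epsilon> * b"
  then have big: "\<epsilon> * b < m k"
    by simp
  have drop: "m (Suc t) \<le> m t" for t
  proof -
    have "0 \<le> \<gamma> * ((m t)\<^sup>2 / (m t + b))"
      using nonneg[of t] assms(2,3) by simp
    with step[of t] show ?thesis by linarith
  qed
  have mono: "m k \<le> m t" if "t \<le> k" for t
    using that by (rule lift_Suc_antimono_le[of m, OF drop])
  have pos: "0 < m t" if "t \<le> k" for t
    using mono[OF that] big assms(3,4) by (smt (verit) mult_pos_pos)
  define h where "h t = b / m t - ln (m t)" for t
  have h_step: "h t + \<gamma> \<le> h (Suc t)" if "Suc t \<le> k" for t
  proof -
    define d where "d = m t - m (Suc t)"
    have p: "0 < m t" "0 < m (Suc t)"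
      using pos that by auto
    have "\<gamma> * (m t)\<^sup>2 \<le> d * (m t + b)"
      using step[of t] p assms(3) by (simp add: d_def field_simps)
    then have "\<gamma> \<le> d * (m t + b) / (m t)\<^sup>2"
      using p by (simp add: field_simps)
    also have "\<dots> = d / m t + b * d / (m t * m t)"
      using p by (simp add: field_simps power2_eq_square)
    also have "d / m t \<le> ln (m t) - ln (m (Suc t))"
    proof -
      have "ln (m (Suc t) / m t) \<le> m (Suc t) / m t - 1"
        using p by (intro ln_le_minus_one) simp
      then show ?thesis
        using p by (simp add: d_def ln_div field_simps)
    qed
    also have "b * d / (m t * m t) \<le> b * d / (m (Suc t) * m t)"
      using p drop[of t] assms(3) by (intro divide_left_mono mult_right_mono) (auto simp: d_def)
    also have "\<dots> = b / m (Suc t) - b / m t"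
      using p by (simp add: d_def field_simps)
    finally show ?thesis
      by (simp add: h_def)
  qed
  have "t \<le> k \<Longrightarrow> h 0 + \<gamma> * real t \<le> h t" for t
  proof (induction t)
    case (Suc t)
    with h_step[of t] show ?case by (simp add: algebra_simps)
  qed simp
  then have "h 0 + \<gamma> * real k \<le> h k"
    by simp
  moreover have "- ln M \<le> h 0"
  proof -
    have "ln (m 0) \<le> ln M" "0 \<le> b / m 0"
      using pos[of 0] assms(3,6) by auto
    then show ?thesis by (simp add: h_def)
  qed
  moreover have "h k < 1 / \<epsilon> - ln (\<epsilon> * b)"
  proof -
    have "0 < \<epsilon> * b" using assms(3,4) by simp
    then have "ln (\<epsilon> * b) < ln (m k)"
      using big by simp
    moreover have "b / m k < b / (\<epsilon> * b)"
      using big assms(3) \<open>0 < \<epsilon> * b\<close> pos[of k]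
      by (intro divide_strict_left_mono) (simp_all add: zero_less_mult_iff)
    moreover have "b / (\<epsilon> * b) = 1 / \<epsilon>"
      using assms(3) by simp
    ultimately show ?thesis
      by (simp add: h_def)
  qed
  moreover have "ln (M / (\<epsilon> * b)) = ln M - ln (\<epsilon> * b)"
    using assms(3,4,7) by (simp add: ln_div)
  ultimately show False
    using k by linarith
qed

section \<open>Expected residual after k rounds\<close>

lemma expectation_finite:
  fixes h :: "'a::finite \<Rightarrow> real"
  shows "measure_pmf.expectation p h = (\<Sum>x\<in>UNIV. pmf p x * h x)"
  by (subst integral_measure_pmf[of UNIV]) auto

text \<open>
  When the sketched residuals all vanish, so do the unsketched ones by the lower embedding
  bound, and both sides are \<open>0\<close>. Otherwise \<open>residual_sketch\<close> makes the pivot law comparable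
  with norm sampling on \<open>A\<close> itself, and the key estimate applies with \<open>c = (1 - \<delta>) / (1 + \<delta>)\<close>.
\<close>

lemma expected_captured_step:
  fixes A C :: "real^'n^'N" and S :: "real^'N^'m" and I :: "'n set"
  assumes SE: "subspace_embedding \<delta> S A" and \<delta>: "0 < \<delta>" "\<delta> < 1"
    and E: "orthonormal_basis_of UNIV (W \<union> W')" "W \<inter> W' = {}"
    and ker: "\<And>w. w \<in> W' \<Longrightarrow> C *v w = 0"
    and card: "card W \<le> r" "0 < r"
    and b: "b = (norm (A - C))\<^sup>2" "0 < b"
  defines "e \<equiv> \<lambda>I. captured W (residual_matrix A I)"
  shows "measure_pmf.expectation
           (if \<forall>i. residual (S ** A) I i = 0 then return_pmf I
            else map_pmf (\<lambda>i. insert i I) (pivot_pmf (S ** A) I)) e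
           \<le> e I - (1 - \<delta>) / (1 + \<delta>) / real r * ((e I)\<^sup>2 / (e I + b))"
proof (cases "\<forall>i. residual (S ** A) I i = 0")
  case True
  have "residual A I i = 0" for i
  proof -
    have "(1 - \<delta>) * residual A I i \<le> 0"
      using residual_sketch(1)[OF SE \<delta>(2), of I i] True by simp
    with \<delta> residual_nonneg[of A I i] show ?thesis
      by (simp add: mult_le_0_iff)
  qed
  then have "(norm (residual_matrix A I))\<^sup>2 = 0"
    unfolding sum_residual[symmetric] by simp
  then have "e I = 0"
    by (simp add: e_def captured_def)
  with True show ?thesis by simp
next
  case False
  define c where "c = (1 - \<delta>) / (1 + \<delta>)"
  have c: "0 < c"
    using \<delta> by (simp add: c_def)
  define R where "R = residual_matrix A I"
  define p where "p i = pmf (pivot_pmf (S ** A) I) i" for i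
  define s where "s = (\<Sum>j\<in>UNIV. residual (S ** A) I j)"
  have p: "p i = residual (S ** A) I i / s" for i
    using False by (simp add: p_def s_def pmf_pivot_pmf)
  have "s \<noteq> 0"
    using False by (auto simp: s_def sum_nonneg_eq_0_iff residual_nonneg)
  then have "0 < s"
    using sum_nonneg[of UNIV "residual (S ** A) I"] by (simp add: s_def residual_nonneg)
  have s_le: "s \<le> (1 + \<delta>) * (norm R)\<^sup>2"
    unfolding s_def R_def sum_residual[symmetric] sum_distrib_left
    by (intro sum_mono residual_sketch(2)[OF SE \<delta>(2)])
  then have R_pos: "0 < (norm R)\<^sup>2"
    using \<open>0 < s\<close> \<delta> by (smt (verit) mult_eq_0_iff zero_le_power2)
  have p_ge: "c * (norm (column i R))\<^sup>2 / (norm R)\<^sup>2 \<le> p i" for i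
  proof -
    have "c * (norm (column i R))\<^sup>2 / (norm R)\<^sup>2 = (1 - \<delta>) * residual A I i / ((1 + \<delta>) * (norm R)\<^sup>2)"
      by (simp add: c_def R_def residual_eq_norm_column)
    also have "\<dots> \<le> (1 - \<delta>) * residual A I i / s"
      using s_le \<open>0 < s\<close> \<delta> R_pos by (intro divide_left_mono) (auto simp: residual_nonneg)
    also have "\<dots> \<le> p i"
      unfolding p using \<open>0 < s\<close> by (intro divide_right_mono residual_sketch(1)[OF SE \<delta>(2)]) simp
    finally show ?thesis .
  qed
  have "sum p UNIV = 1"
    unfolding p_def by (rule sum_pmf_eq_1) auto
  have unit: "norm w = 1" if "w \<in> W" for w
    using E that by (auto simp: orthonormal_basis_of_def)
  have "measure_pmf.expectation
           (if \<forall>i. residual (S ** A) I i = 0 then return_pmf I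
            else map_pmf (\<lambda>i. insert i I) (pivot_pmf (S ** A) I)) e
      = (\<Sum>i\<in>UNIV. p i * e (insert i I))"
    unfolding if_not_P[OF False] integral_map_pmf by (simp add: expectation_finite p_def)
  also have "\<dots> \<le> e I - c / real r * (e I)\<^sup>2 / (norm R)\<^sup>2"
    unfolding e_def R_def
    by (rule expected_captured_insert)
      (use unit card p_ge \<open>sum p UNIV = 1\<close> c in \<open>simp_all add: R_def\<close>)
  also have "\<dots> \<le> e I - c / real r * ((e I)\<^sup>2 / (e I + b))"
  proof -
    have "(norm R)\<^sup>2 \<le> e I + b"
      unfolding R_def e_def b by (rule norm_residual_le_captured[OF E ker])
    then have "0 < (e I + b) * (norm R)\<^sup>2"
      using R_pos by (intro mult_pos_pos) linarith+
    with \<open>(norm R)\<^sup>2 \<le> e I + b\<close> have "c / real r * ((e I)\<^sup>2 / (e I + b)) \<le> c / real r * ((e I)\<^sup>2 / (norm R)\<^sup>2)"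
      using R_pos c by (intro mult_left_mono divide_left_mono) auto
    then show ?thesis by simp
  qed
  finally show ?thesis
    by (simp add: c_def)
qed

text \<open>
  The one-step bound is a concave function of the current energy, so averaging over the
  current index set only improves it: the expectations satisfy the same recursion.
\<close>

lemma expected_captured_recursion:
  fixes A C :: "real^'n^'N" and S :: "real^'N^'m"
  assumes SE: "subspace_embedding \<delta> S A" and \<delta>: "0 < \<delta>" "\<delta> < 1"
    and E: "orthonormal_basis_of UNIV (W \<union> W')" "W \<inter> W' = {}"
    and ker: "\<And>w. w \<in> W' \<Longrightarrow> C *v w = 0"
    and card: "card W \<le> r" "0 < r"
    and b: "b = (norm (A - C))\<^sup>2" "0 < b"
  defines "e \<equiv> \<lambda>I. captured W (residual_matrix A I)"
    and "\<gamma> \<equiv> (1 - \<delta>) / (1 + \<delta>) / real r"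
  defines "m \<equiv> \<lambda>t. measure_pmf.expectation (norm_sampling t (S ** A)) e"
  shows "m (Suc t) \<le> m t - \<gamma> * ((m t)\<^sup>2 / (m t + b))"
proof -
  define q where "q I = pmf (norm_sampling t (S ** A)) I" for I
  have q: "0 \<le> q I" "sum q UNIV = 1" for I
    unfolding q_def by (auto intro!: sum_pmf_eq_1)
  have m: "m t = (\<Sum>I\<in>UNIV. q I * e I)"
    by (simp add: m_def q_def expectation_finite)
  have e: "0 \<le> e I" for I
    by (simp add: e_def captured_nonneg)
  have "0 \<le> m t"
    unfolding m by (intro sum_nonneg mult_nonneg_nonneg q e)
  have "0 \<le> \<gamma>"
    using \<delta> by (simp add: \<gamma>_def)
  \<comment> \<open>The slope of \<open>x\<^sup>2 / (x + b)\<close> at the mean \<open>x = m t\<close>.\<close>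
  define \<beta> where "\<beta> = 1 - b\<^sup>2 / (m t + b)\<^sup>2"
  have "m (Suc t) \<le> (\<Sum>I\<in>UNIV. q I * (e I - \<gamma> * ((e I)\<^sup>2 / (e I + b))))"
    unfolding m_def norm_sampling.simps
    by (subst pmf_expectation_bind[of UNIV]; simp only: finite subset_UNIV real_scaleR_def)
      (unfold q_def e_def \<gamma>_def, intro sum_mono mult_left_mono pmf_nonneg
        expected_captured_step[OF SE \<delta> E ker card b])
  also have "\<dots> \<le> (\<Sum>I\<in>UNIV. q I * (e I - \<gamma> * ((m t)\<^sup>2 / (m t + b) + \<beta> * (e I - m t))))"
    unfolding \<beta>_def using \<open>0 \<le> \<gamma>\<close> \<open>0 \<le> m t\<close> b(2) q e
    by (intro sum_mono mult_left_mono diff_left_mono square_over_shift_tangent) auto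
  also have "\<dots> = m t - \<gamma> * ((m t)\<^sup>2 / (m t + b))"
  proof -
    define a where "a = \<gamma> * ((m t)\<^sup>2 / (m t + b)) - \<gamma> * \<beta> * m t"
    have "(\<Sum>I\<in>UNIV. q I * (e I - \<gamma> * ((m t)\<^sup>2 / (m t + b) + \<beta> * (e I - m t))))
        = (\<Sum>I\<in>UNIV. (1 - \<gamma> * \<beta>) * (q I * e I) - a * q I)"
      by (intro sum.cong) (simp_all add: a_def algebra_simps)
    also have "\<dots> = (1 - \<gamma> * \<beta>) * m t - a"
      unfolding sum_subtractf sum_distrib_left[symmetric] q(2) m by simp
    finally show ?thesis
      by (simp add: a_def algebra_simps)
  qed
  finally show ?thesis .
qed

text \<open>
  With \<open>W\<close> a basis of the row space of \<open>C\<close>, the scalar recursion drives the expected energy in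
  \<open>W\<close> below \<open>\<epsilon> b\<close>, and the energy outside \<open>W\<close> never exceeds \<open>b\<close>.
\<close>

lemma expected_residual_positive_error:
  fixes A C :: "real^'n^'N" and S :: "real^'N^'m"
  assumes SE: "subspace_embedding \<delta> S A" and \<delta>: "0 < \<delta>" "\<delta> < 1" and "0 < \<epsilon>"
    and rank: "rank C \<le> r" and b: "b = (norm (A - C))\<^sup>2" "0 < b" and "A \<noteq> 0"
    and k: "(1 + \<delta>) / (1 - \<delta>) * (real r / \<epsilon> + real r * ln ((norm A)\<^sup>2 / (\<epsilon> * b))) \<le> real k"
  shows "measure_pmf.expectation (norm_sampling k (S ** A)) (\<lambda>J. (norm (residual_matrix A J))\<^sup>2)
           \<le> (1 + \<epsilon>) * b"
proof -
  obtain W W' where E: "orthonormal_basis_of UNIV (W \<union> W')" "W \<inter> W' = {}"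
    and W: "card W = rank C" and ker: "\<And>w. w \<in> W' \<Longrightarrow> C *v w = 0"
    by (rule row_space_basis[of C]) blast
  have fin: "finite W" "finite W'"
    using orthonormal_basis_finite[OF E(1)] by auto
  define e where "e I = captured W (residual_matrix A I)" for I
  define m where "m t = measure_pmf.expectation (norm_sampling t (S ** A)) e" for t
  have "m k \<le> \<epsilon> * b"
  proof (cases "r = 0")
    case True
    then have "W = {}"
      using W rank fin by simp
    then show ?thesis
      using \<open>0 < \<epsilon>\<close> b(2) by (simp add: m_def e_def[abs_def] captured_def)
  next
    case False
    then have r: "card W \<le> r" "0 < r"
      using W rank by auto
    define \<gamma> where "\<gamma> = (1 - \<delta>) / (1 + \<delta>) / real r"
    show ?thesis
    proof (rule recursion_bound)
      show "m (Suc t) \<le> m t - \<gamma> * ((m t)\<^sup>2 / (m t + b))" for t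
        unfolding m_def e_def \<gamma>_def
        by (rule expected_captured_recursion[OF SE \<delta> E ker r b])
      show "0 \<le> \<gamma>" "0 < b" "0 < \<epsilon>"
        using \<delta> b \<open>0 < \<epsilon>\<close> by (auto simp: \<gamma>_def)
      show "0 \<le> m t" for t
        unfolding m_def e_def by (intro Bochner_Integration.integral_nonneg captured_nonneg)
      have "m 0 = captured W (residual_matrix A {})"
        by (simp add: m_def e_def)
      also have "\<dots> \<le> captured W A"
        unfolding captured_def
        using residual_matrix_minimal[OF span_zero, of A "{}"] by (intro sum_mono power_mono) auto
      also have "\<dots> \<le> captured (W \<union> W') A"
        unfolding captured_def using fin by (intro sum_mono2) auto
      also have "\<dots> = (norm A)\<^sup>2"
        by (rule captured_orthonormal_basis[OF E(1)])
      finally show "m 0 \<le> (norm A)\<^sup>2" .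
      show "0 < (norm A)\<^sup>2"
        using \<open>A \<noteq> 0\<close> by simp
      have "\<gamma> * ((1 + \<delta>) / (1 - \<delta>) * (real r / \<epsilon> + real r * ln ((norm A)\<^sup>2 / (\<epsilon> * b)))) \<le> \<gamma> * real k"
        using k \<open>0 \<le> \<gamma>\<close> by (rule mult_left_mono)
      moreover have "\<gamma> * ((1 + \<delta>) / (1 - \<delta>) * (real r / \<epsilon> + real r * ln ((norm A)\<^sup>2 / (\<epsilon> * b))))
          = 1 / \<epsilon> + ln ((norm A)\<^sup>2 / (\<epsilon> * b))"
      proof -
        have "\<gamma> * ((1 + \<delta>) / (1 - \<delta>)) = 1 / real r"
          using \<delta> by (simp add: \<gamma>_def)
        then have "\<gamma> * ((1 + \<delta>) / (1 - \<delta>) * (real r / \<epsilon> + real r * ln ((norm A)\<^sup>2 / (\<epsilon> * b))))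
          = 1 / real r * (real r / \<epsilon> + real r * ln ((norm A)\<^sup>2 / (\<epsilon> * b)))"
          by (metis mult.assoc)
        then show ?thesis
          using r by (simp add: distrib_left)
      qed
      ultimately show "1 / \<epsilon> + ln ((norm A)\<^sup>2 / (\<epsilon> * b)) \<le> \<gamma> * real k"
        by simp
    qed
  qed
  moreover have "measure_pmf.expectation (norm_sampling k (S ** A)) (\<lambda>J. (norm (residual_matrix A J))\<^sup>2)
      \<le> measure_pmf.expectation (norm_sampling k (S ** A)) (\<lambda>J. e J + b)"
    unfolding e_def b
    by (intro integral_mono norm_residual_le_captured[OF E ker])
      (auto intro!: integrable_measure_pmf_finite)
  moreover have "\<dots> = m k + b"
    unfolding m_def by (subst Bochner_Integration.integral_add) (auto intro!: integrable_measure_pmf_finite)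
  ultimately show ?thesis
    by (simp add: algebra_simps)
qed

section \<open>Exact recovery of low-rank matrices\<close>

text \<open>
  A column with positive probability lies outside the current span, so a round that does not
  stop raises the dimension by one.
\<close>

lemma norm_sampling_exhausts_or_grows:
  fixes B :: "real^'n^'m"
  assumes "J \<in> set_pmf (norm_sampling k B)"
  shows "(\<forall>i. residual B J i = 0) \<or> k \<le> dim ((\<lambda>i. column i B) ` J)"
  using assms
proof (induction k arbitrary: J)
  case (Suc k)
  then obtain I where I: "I \<in> set_pmf (norm_sampling k B)"
    and J: "J \<in> set_pmf (if \<forall>i. residual B I i = 0 then return_pmf I
            else map_pmf (\<lambda>i. insert i I) (pivot_pmf B I))"
    by auto
  show ?case
  proof (cases "\<forall>i. residual B I i = 0")
    case True
    with J show ?thesis by simp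
  next
    case False
    from J obtain i where i: "i \<in> set_pmf (pivot_pmf B I)" "J = insert i I"
      unfolding if_not_P[OF False] by auto
    then have "residual B I i \<noteq> 0"
      using False by (auto simp: set_pmf_iff pmf_pivot_pmf)
    then have "dim ((\<lambda>i. column i B) ` J) = Suc (dim ((\<lambda>i. column i B) ` I))"
      using i(2) by (simp add: dim_insert residual_zero_iff)
    with Suc.IH[OF I] False show ?thesis by simp
  qed
qed simp

text \<open>
  For a matrix of exactly low rank the scalar recursion gives only geometric decay. Here every
  outcome is exact: once as many rounds as the rank of \<open>A\<close> have passed, the chosen columns
  span the column space.
\<close>

lemma residual_matrix_zero_of_small_rank:
  fixes A :: "real^'n^'N" and S :: "real^'N^'m"
  assumes SE: "subspace_embedding \<delta> S A" and \<delta>: "\<delta> < 1"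
    and "rank A \<le> k" and J: "J \<in> set_pmf (norm_sampling k (S ** A))"
  shows "residual_matrix A J = 0"
proof -
  let ?B = "S ** A"
  have "residual ?B J i = 0" for i
  proof (rule disjE[OF norm_sampling_exhausts_or_grows[OF J]])
    assume "k \<le> dim ((\<lambda>i. column i ?B) ` J)"
    moreover have "dim (columns ?B) \<le> rank A"
      using rank_mul_le_right[of S A] by (simp add: column_rank_def)
    ultimately have "dim (columns ?B) \<le> dim ((\<lambda>i. column i ?B) ` J)"
      using \<open>rank A \<le> k\<close> by linarith
    moreover have "(\<lambda>i. column i ?B) ` J \<subseteq> columns ?B"
      by (auto simp: columns_def)
    ultimately have "span ((\<lambda>i. column i ?B) ` J) = span (columns ?B)"
      by (intro dim_eq_span)
    moreover have "column i ?B \<in> span (columns ?B)"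
      by (intro span_base) (auto simp: columns_def)
    ultimately show ?thesis
      by (simp add: residual_zero_iff)
  qed blast
  then have "(1 - \<delta>) * residual A J i \<le> 0" for i
    using residual_sketch(1)[OF SE \<delta>, of J i] by simp
  then have "residual A J i = 0" for i
    using \<delta> residual_nonneg[of A J i] by (simp add: mult_le_0_iff antisym)
  then have "(norm (residual_matrix A J))\<^sup>2 = 0"
    unfolding sum_residual[symmetric] by simp
  then show ?thesis by simp
qed

section \<open>Sketch-and-solve least squares\<close>

lemma inner_zero_of_minimal_on_line:
  fixes u g :: "'a::real_inner"
  assumes "\<And>t. norm u \<le> norm (u + t *\<^sub>R g)"
  shows "u \<bullet> g = 0"
proof (cases "g = 0")
  case False
  \<comment> \<open>The minimiser of the quadratic \<open>t \<mapsto> \<parallel>u + t g\<parallel>\<^sup>2\<close>.\<close>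
  define t where "t = - (u \<bullet> g) / (g \<bullet> g)"
  have "(norm u)\<^sup>2 \<le> (norm (u + t *\<^sub>R g))\<^sup>2"
    using assms by (rule power_mono) simp
  also have "\<dots> = (norm u)\<^sup>2 + 2 * t * (u \<bullet> g) + t\<^sup>2 * (g \<bullet> g)"
    unfolding power2_norm_eq_inner
    by (simp add: inner_add_left inner_add_right inner_commute[of g u] power2_eq_square algebra_simps)
  also have "\<dots> = (norm u)\<^sup>2 - (u \<bullet> g)\<^sup>2 / (g \<bullet> g)"
    using False by (simp add: t_def power2_eq_square)
  finally have "(u \<bullet> g)\<^sup>2 / (g \<bullet> g) \<le> 0"
    by simp
  moreover have "0 < g \<bullet> g"
    using False by simp
  ultimately show ?thesis
    by (simp add: pos_divide_le_eq del: inner_gt_zero_iff)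
qed simp

lemma norm_eq_of_orthogonal_reflect:
  fixes a b :: "'a::real_inner"
  assumes "a \<bullet> b = 0"
  shows "norm (a + b) = norm (a - b)"
  using assms by (simp add: norm_eq inner_add_left inner_add_right inner_diff_left inner_diff_right
      inner_commute[of b a])

lemma residual_matrix_inner_col_sub:
  fixes A :: "real^'n^'m" and V X :: "real^'p^'n"
  shows "(residual_matrix A J ** X) \<bullet> (col_sub A J ** V) = 0"
  unfolding inner_matrix_columns column_matrix_mult
  by (intro sum.neutral ballI residual_matrix_orthogonal col_sub_mult_vec_in_span)

text \<open>
  Write the error of the sketched solution as \<open>R - Y\<close>, with \<open>R\<close> the optimal error and \<open>Y\<close> in
  the range of \<open>A\<^sub>J\<close>; then \<open>R\<close> and \<open>Y\<close> are orthogonal, and \<open>\<parallel>Y\<parallel>\<close> has to be bounded. The normal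
  equations of the sketched problem say that \<open>S (R - Y)\<close> and \<open>S Y\<close> are orthogonal, so
  \<open>S (R - Y + s Y)\<close> and \<open>S (R - Y - s Y)\<close> have equal norms for every \<open>s\<close>. The embedding then
  compares the norms of \<open>R + (s - 1) Y\<close> and \<open>R - (s + 1) Y\<close>, of which the second is longer for
  \<open>s > 0\<close>; the choice \<open>s = 1 / \<delta>\<close> gives \<open>\<parallel>Y\<parallel>\<^sup>2 \<le> \<delta>\<^sup>2 / (1 - \<delta>\<^sup>2) \<parallel>R\<parallel>\<^sup>2\<close>. The direct argument,
  applying the embedding to both errors, would give only the factor \<open>(1 + \<delta>) / (1 - \<delta>)\<close>.
\<close>

lemma sketched_least_squares:
  fixes A :: "real^'n^'N" and S :: "real^'N^'m" and X :: "real^'n^'n"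
  assumes SE: "subspace_embedding \<delta> S A" and \<delta>: "0 < \<delta>" "\<delta> < 1"
    and opt: "is_arg_min (\<lambda>X. norm (col_sub (S ** A) J ** X - S ** A)) (\<lambda>_. True) X"
  shows "(1 - \<delta>\<^sup>2) * (norm (A - col_sub A J ** X))\<^sup>2 \<le> (norm (residual_matrix A J))\<^sup>2"
proof -
  define R where "R = residual_matrix A J"
  obtain X0 :: "real^'n^'n" where X0: "R = A - col_sub A J ** X0"
    unfolding R_def by (rule residual_matrix_eq_col_sub)
  define D where "D = X - X0"
  define Y where "Y = col_sub A J ** D"
  have RY: "A - col_sub A J ** X = R - Y"
    by (simp add: X0 Y_def D_def matrix_mult_diff_right)
  have "(residual_matrix A J ** mat 1) \<bullet> Y = 0"
    unfolding Y_def by (rule residual_matrix_inner_col_sub)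
  then have orth: "R \<bullet> Y = 0"
    by (simp add: R_def)
  have pyth: "(norm (R + t *\<^sub>R Y))\<^sup>2 = (norm R)\<^sup>2 + t\<^sup>2 * (norm Y)\<^sup>2" for t
    unfolding power2_norm_eq_inner using orth
    by (simp add: inner_add_left inner_add_right inner_commute[of Y R] power2_eq_square)
  have sketch: "S ** (R - Y) = S ** A - col_sub (S ** A) J ** X"
    by (simp add: RY[symmetric] col_sub_matrix_mult matrix_mult_diff_right matrix_mul_assoc)
  have normal: "(S ** (R - Y)) \<bullet> (S ** Y) = 0"
  proof (rule inner_zero_of_minimal_on_line)
    fix t :: real
    have "norm (col_sub (S ** A) J ** X - S ** A)
        \<le> norm (col_sub (S ** A) J ** (X - t *\<^sub>R D) - S ** A)"
      using opt by (auto simp: is_arg_min_def not_less)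
    moreover have "S ** (R - Y) + t *\<^sub>R (S ** Y) = S ** A - col_sub (S ** A) J ** (X - t *\<^sub>R D)"
      unfolding sketch
      by (simp add: Y_def col_sub_matrix_mult matrix_mult_diff_right matrix_mult_scaleR_right
          matrix_mul_assoc)
    ultimately show "norm (S ** (R - Y)) \<le> norm (S ** (R - Y) + t *\<^sub>R (S ** Y))"
      unfolding sketch by (simp only: norm_minus_commute)
  qed
  \<comment> \<open>All matrices involved have their columns in the column space of \<open>A\<close>, where the embedding applies.\<close>
  have range: "\<exists>C. R + t *\<^sub>R Y = A ** C" for t
  proof -
    define P :: "real^'n^'n" where "P = col_sub (mat 1) J"
    have P: "col_sub A J = A ** P"
      unfolding P_def by (rule col_sub_eq_matrix_mult)
    have "R + t *\<^sub>R Y = A ** (mat 1 - P ** X0 + t *\<^sub>R (P ** D))"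
      by (simp add: X0 Y_def P matrix_add_ldistrib matrix_mult_diff_right
          matrix_mult_scaleR_right matrix_mul_assoc)
    then show ?thesis by blast
  qed
  define s where "s = 1 / \<delta>"
  have "\<delta> * s = 1"
    using \<delta> by (simp add: s_def)
  have "norm (S ** (R - Y) + s *\<^sub>R (S ** Y)) = norm (S ** (R - Y) - s *\<^sub>R (S ** Y))"
    using normal by (intro norm_eq_of_orthogonal_reflect) simp
  moreover have "S ** (R - Y) + s *\<^sub>R (S ** Y) = S ** (R + (s - 1) *\<^sub>R Y)"
    by (simp add: matrix_add_ldistrib matrix_mult_diff_right matrix_mult_scaleR_right
        scaleR_left_diff_distrib)
  moreover have "S ** (R - Y) - s *\<^sub>R (S ** Y) = S ** (R + (- s - 1) *\<^sub>R Y)"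
    by (simp add: matrix_add_ldistrib matrix_mult_diff_right matrix_mult_scaleR_right
        scaleR_left_diff_distrib matrix_mult_scaleR_right[of S "- 1", simplified])
  ultimately have eq: "norm (S ** (R + (s - 1) *\<^sub>R Y)) = norm (S ** (R + (- s - 1) *\<^sub>R Y))"
    by simp
  have "(1 - \<delta>) * ((norm R)\<^sup>2 + (- s - 1)\<^sup>2 * (norm Y)\<^sup>2)
      \<le> (norm (S ** (R + (- s - 1) *\<^sub>R Y)))\<^sup>2"
    using range[of "- s - 1"] subspace_embedding_matrix_mult(1)[OF SE] unfolding pyth[symmetric]
    by auto
  also have "\<dots> \<le> (1 + \<delta>) * ((norm R)\<^sup>2 + (s - 1)\<^sup>2 * (norm Y)\<^sup>2)"
    using range[of "s - 1"] subspace_embedding_matrix_mult(2)[OF SE]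
    unfolding pyth[symmetric] eq[symmetric] by auto
  finally have "(1 - \<delta>) * ((norm R)\<^sup>2 + (- s - 1)\<^sup>2 * (norm Y)\<^sup>2)
      \<le> (1 + \<delta>) * ((norm R)\<^sup>2 + (s - 1)\<^sup>2 * (norm Y)\<^sup>2)" .
  moreover have "(1 + \<delta>) * ((norm R)\<^sup>2 + (s - 1)\<^sup>2 * (norm Y)\<^sup>2)
      - (1 - \<delta>) * ((norm R)\<^sup>2 + (- s - 1)\<^sup>2 * (norm Y)\<^sup>2)
      = 2 * (\<delta> * (norm R)\<^sup>2 - (s - \<delta>) * (norm Y)\<^sup>2)"
    using \<open>\<delta> * s = 1\<close> by algebra
  ultimately have "0 \<le> 2 * (\<delta> * (norm R)\<^sup>2 - (s - \<delta>) * (norm Y)\<^sup>2)"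
    by (metis diff_ge_0_iff_ge)
  then have "(s - \<delta>) * (norm Y)\<^sup>2 \<le> \<delta> * (norm R)\<^sup>2"
    by simp
  then have "\<delta> * ((s - \<delta>) * (norm Y)\<^sup>2) \<le> \<delta> * (\<delta> * (norm R)\<^sup>2)"
    using \<delta> by (intro mult_left_mono) simp_all
  moreover have "\<delta> * ((s - \<delta>) * (norm Y)\<^sup>2) = (1 - \<delta>\<^sup>2) * (norm Y)\<^sup>2"
    using \<open>\<delta> * s = 1\<close> by algebra
  moreover have "\<delta> * (\<delta> * (norm R)\<^sup>2) = \<delta>\<^sup>2 * (norm R)\<^sup>2"
    by (simp add: power2_eq_square)
  ultimately have "(1 - \<delta>\<^sup>2) * (norm Y)\<^sup>2 \<le> \<delta>\<^sup>2 * (norm R)\<^sup>2"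
    by simp
  moreover have "(norm (R - Y))\<^sup>2 = (norm R)\<^sup>2 + (norm Y)\<^sup>2"
    using pyth[of "- 1"] by simp
  ultimately show ?thesis
    unfolding RY R_def[symmetric] by (simp add: algebra_simps)
qed

section \<open>Expected error of the interpolative decomposition\<close>

text \<open>
  If \<open>A = Ar\<close> then \<open>\<eta> = 0\<close>, where \<open>1 / (\<epsilon> \<eta>)\<close> and its logarithm both take the value \<open>0\<close>. The
  bound on \<open>k\<close> still gives \<open>k \<ge> r / \<epsilon> \<ge> r\<close>, enough for exact recovery. The same happens for
  \<open>A = 0\<close>.
\<close>

lemma expected_residual_bound:
  fixes A Ar :: "real^'n^'N" and S :: "real^'N^'m"
  assumes \<epsilon>: "0 < \<epsilon>" "\<epsilon> < 1" and \<delta>: "0 < \<delta>" "\<delta> < 1" and SE: "subspace_embedding \<delta> S A"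
    and rank: "rank Ar \<le> r"
    and \<eta>: "\<eta> = (norm (A - Ar))\<^sup>2 / (norm A)\<^sup>2"
    and k: "(1 + \<delta>) / (1 - \<delta>) * (real r / \<epsilon> + real r * ln (1 / (\<epsilon> * \<eta>))) \<le> real k"
  shows "measure_pmf.expectation (norm_sampling k (S ** A)) (\<lambda>J. (norm (residual_matrix A J))\<^sup>2)
           \<le> (1 + \<epsilon>) * (norm (A - Ar))\<^sup>2"
proof (cases "A \<noteq> 0 \<and> A \<noteq> Ar")
  case True
  have "1 / (\<epsilon> * \<eta>) = (norm A)\<^sup>2 / (\<epsilon> * (norm (A - Ar))\<^sup>2)"
    by (simp add: \<eta>)
  then show ?thesis
    using True k by (intro expected_residual_positive_error[OF SE \<delta> \<epsilon>(1) rank refl]) auto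
next
  case False
  then have "rank A \<le> r"
    using rank by auto
  have "\<eta> = 0"
    using False by (auto simp: \<eta>)
  have "1 * (real r / 1) \<le> (1 + \<delta>) / (1 - \<delta>) * (real r / \<epsilon>)"
    using \<epsilon> \<delta> by (intro mult_mono divide_left_mono) auto
  also have "\<dots> \<le> real k"
    using k by (simp add: \<open>\<eta> = 0\<close>)
  finally have "rank A \<le> k"
    using \<open>rank A \<le> r\<close> by simp
  then have "measure_pmf.expectation (norm_sampling k (S ** A)) (\<lambda>J. (norm (residual_matrix A J))\<^sup>2)
      = measure_pmf.expectation (norm_sampling k (S ** A)) (\<lambda>J. 0)"
    using residual_matrix_zero_of_small_rank[OF SE \<delta>(2)]
    by (intro integral_cong_AE AE_pmfI) simp_all
  then show ?thesis
    using \<epsilon> by simp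
qed

theorem theorem2p8:
  fixes A Ar :: "real^'n^'N" and S :: "real^'N^'m"
    and \<epsilon> \<delta> \<eta> :: real and k r :: nat
  assumes "0 < \<epsilon>" "\<epsilon> < 1" "0 < \<delta>" "\<delta> < 1"
    and "subspace_embedding \<delta> S A"
    and "best_rank_approx r A Ar"
    and "\<eta> = (norm (A - Ar))\<^sup>2 / (norm A)\<^sup>2"
    and "real k \<ge> (1 + \<delta>) / (1 - \<delta>) * (real r / \<epsilon> + real r * ln (1 / (\<epsilon> * \<eta>)))"
  shows "measure_pmf.expectation (norm_sampling k (S ** A))
           (\<lambda>J. INF X :: real^'n^'n. (norm (A - col_sub A J ** X))\<^sup>2)
           \<le> (1 + \<epsilon>) * (norm (A - Ar))\<^sup>2
       \<and> (\<forall>Xs :: 'n set \<Rightarrow> real^'n^'n.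
            (\<forall>J \<in> set_pmf (norm_sampling k (S ** A)).
               is_arg_min (\<lambda>X. norm (col_sub (S ** A) J ** X - S ** A)) (\<lambda>_. True) (Xs J)) \<longrightarrow>
            measure_pmf.expectation (norm_sampling k (S ** A))
              (\<lambda>J. (norm (A - col_sub A J ** Xs J))\<^sup>2)
              \<le> (1 + \<epsilon>) * inverse (1 - \<delta>) * (norm (A - Ar))\<^sup>2)"
proof (intro conjI allI impI)
  let ?P = "norm_sampling k (S ** A)"
  have "rank Ar \<le> r"
    using assms(6) by (simp add: best_rank_approx_def is_arg_min_def)
  note bound = expected_residual_bound[OF assms(1-5) this assms(7,8)]
  have "measure_pmf.expectation ?P (\<lambda>J. INF X :: real^'n^'n. (norm (A - col_sub A J ** X))\<^sup>2)
      \<le> measure_pmf.expectation ?P (\<lambda>J. (norm (residual_matrix A J))\<^sup>2)"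
    by (intro integral_mono INF_col_sub_le) (auto intro!: integrable_measure_pmf_finite)
  with bound show "measure_pmf.expectation ?P (\<lambda>J. INF X :: real^'n^'n. (norm (A - col_sub A J ** X))\<^sup>2)
      \<le> (1 + \<epsilon>) * (norm (A - Ar))\<^sup>2"
    by linarith
  fix Xs :: "'n set \<Rightarrow> real^'n^'n"
  assume opt: "\<forall>J \<in> set_pmf ?P.
    is_arg_min (\<lambda>X. norm (col_sub (S ** A) J ** X - S ** A)) (\<lambda>_. True) (Xs J)"
  have "(norm (A - col_sub A J ** Xs J))\<^sup>2 \<le> inverse (1 - \<delta>) * (norm (residual_matrix A J))\<^sup>2"
    if "J \<in> set_pmf ?P" for J
  proof -
    have "(1 - \<delta>) * (norm (A - col_sub A J ** Xs J))\<^sup>2 \<le> (1 - \<delta>\<^sup>2) * (norm (A - col_sub A J ** Xs J))\<^sup>2"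
      using assms(3,4) by (intro mult_right_mono) (simp_all add: power2_eq_square mult_left_le)
    also have "\<dots> \<le> (norm (residual_matrix A J))\<^sup>2"
      using opt that by (intro sketched_least_squares[OF assms(5,3,4)]) blast
    finally show ?thesis
      using assms(4) by (simp add: field_simps)
  qed
  then have "measure_pmf.expectation ?P (\<lambda>J. (norm (A - col_sub A J ** Xs J))\<^sup>2)
      \<le> measure_pmf.expectation ?P (\<lambda>J. inverse (1 - \<delta>) * (norm (residual_matrix A J))\<^sup>2)"
    by (intro integral_mono_AE AE_pmfI) (auto intro!: integrable_measure_pmf_finite)
  also have "\<dots> = inverse (1 - \<delta>) * measure_pmf.expectation ?P (\<lambda>J. (norm (residual_matrix A J))\<^sup>2)"
    by (rule integral_mult_right_zero)
  also have "\<dots> \<le> inverse (1 - \<delta>) * ((1 + \<epsilon>) * (norm (A - Ar))\<^sup>2)"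
    using bound assms(4) by (intro mult_left_mono) simp_all
  finally show "measure_pmf.expectation ?P (\<lambda>J. (norm (A - col_sub A J ** Xs J))\<^sup>2)
      \<le> (1 + \<epsilon>) * inverse (1 - \<delta>) * (norm (A - Ar))\<^sup>2"
    by (simp only: ac_simps)
qed

end
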